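(* Let $G=(V,E)$ be any connected $(k,l)$-bi-regular graph, and let $f\neq 0$ be a non-negative function on $V$. Let $\alpha(f)$ and $\beta(f)$ be the exponential growth rates of the sums of $f$ over endpoints of non-backtracking walks and of all walks in $G$, respectively, as defined in the context. Then $$\beta(f)=\begin{cases}\sqrt{k-1}+\sqrt{l-1} & \text{if } \alpha(f)\le (k-1)^{1/4}(l-1)^{1/4},\\[4pt] \left(\alpha(f)+\dfrac{k-1}{\alpha(f)}\right)^{1/2}\left(\alpha(f)+\dfrac{l-1}{\alpha(f)}\right)^{1/2} & \text{if } \alpha(f)\ge (k-1)^{1/4}(l-1)^{1/4}.\end{cases}$$
   Context: A $(k,l)$-bi-regular graph is a graph $G=(V,E)$ whose vertex set is a disjoint union $V=U\sqcup W$ such that every edge joins a vertex of $U$ to a vertex of $W$, every vertex of $U$ has degree $k$ and every vertex of $W$ has degree $l$. Fix a vertex $v\in V$. A walk of length $r$ from $v$ is a sequence of $r$ consecutive edge traversals starting at $v$; it is non-backtracking if no edge traversal is immediately followed by the traversal of the same edge in the opposite direction. Write $\mathrm{end}(p)$ for the final vertex of a walk $p$. For non-zero $f:V\to\mathbb{R}_{\ge 0}$ and $r\in\mathbb{N}$ put $$a_r(f)=\sum_{p} f(\mathrm{end}(p)) \quad\text{(sum over non-backtracking walks } p \text{ from } v \text{ of length } r),$$ $$b_r(f)=\sum_{p} f(\mathrm{end}(p)) \quad\text{(sum over all walks } p \text{ from } v \text{ of length } r),$$ and $$\alpha(f)=\limsup_{r\to\infty}a_r(f)^{1/r},\qquad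 \beta(f)=\limsup_{r\to\infty}b_r(f)^{1/r}.$$ The values $\alpha(f)$ and $\beta(f)$ do not depend on the choice of $v$.
   Formalization: The degrees are assumed to satisfy k ≥ 2 and l ≥ 2; for k = 1 the graph is a star with l leaves, where α(f) = 0 but β(f) = √l rather than √(l−1) (symmetrically for l = 1), and for k = 0 or l = 0 the formula is undefined. *)

theory Defs
  imports "HOL-Analysis.Analysis" "Graph_Theory.Graph_Theory"
begin

text \<open>
  An undirected graph, possibly infinite and possibly with parallel edges, is a
  \<^locale>\<open>bidirected_digraph\<close>: the two arcs e and arev e are the two traversals of one edge.
  There are no loops at a vertex of a bi-regular graph, so the degree of a vertex is its out-degree.
  For k, l > 0 the degree conditions force local finiteness, since the cardinality of
  an infinite set is 0.
\<close>

definition biregular ::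
    "('v, 'e) pre_digraph \<Rightarrow> 'v set \<Rightarrow> 'v set \<Rightarrow> nat \<Rightarrow> nat \<Rightarrow> bool" where
  "biregular G U W k l \<longleftrightarrow>
     verts G = U \<union> W \<and> U \<inter> W = {} \<and>
     (\<forall>e \<in> arcs G. (tail G e \<in> U \<and> head G e \<in> W) \<or> (tail G e \<in> W \<and> head G e \<in> U)) \<and>
     (\<forall>u \<in> U. out_degree G u = k) \<and>
     (\<forall>w \<in> W. out_degree G w = l)"

definition walks :: "('v, 'e) pre_digraph \<Rightarrow> 'v \<Rightarrow> nat \<Rightarrow> 'e awalk set" where
  "walks G v r = {p. (\<exists>w. pre_digraph.awalk G v p w) \<and> length p = r}"

definition nb_walks ::
    "('v, 'e) pre_digraph \<Rightarrow> ('e \<Rightarrow> 'e) \<Rightarrow> 'v \<Rightarrow> nat \<Rightarrow> 'e awalk set" where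
  "nb_walks G arev v r = {p \<in> walks G v r. successively (\<lambda>e e'. e' \<noteq> arev e) p}"

definition nb_walk_sum ::
    "('v, 'e) pre_digraph \<Rightarrow> ('e \<Rightarrow> 'e) \<Rightarrow> 'v \<Rightarrow> ('v \<Rightarrow> real) \<Rightarrow> nat \<Rightarrow> real" where
  "nb_walk_sum G arev v f r = (\<Sum>p \<in> nb_walks G arev v r. f (pre_digraph.awlast G v p))"

definition walk_sum :: "('v, 'e) pre_digraph \<Rightarrow> 'v \<Rightarrow> ('v \<Rightarrow> real) \<Rightarrow> nat \<Rightarrow> real" where
  "walk_sum G v f r = (\<Sum>p \<in> walks G v r. f (pre_digraph.awlast G v p))"

text \<open>
  On an infinite graph f may grow arbitrarily fast along walks, so the growth rates are
  extended reals.
\<close>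

definition nb_growth ::
    "('v, 'e) pre_digraph \<Rightarrow> ('e \<Rightarrow> 'e) \<Rightarrow> 'v \<Rightarrow> ('v \<Rightarrow> real) \<Rightarrow> ereal" where
  "nb_growth G arev v f = limsup (\<lambda>r. ereal (root r (nb_walk_sum G arev v f r)))"

definition walk_growth :: "('v, 'e) pre_digraph \<Rightarrow> 'v \<Rightarrow> ('v \<Rightarrow> real) \<Rightarrow> ereal" where
  "walk_growth G v f = limsup (\<lambda>r. ereal (root r (walk_sum G v f r)))"

definition ereal_sqrt :: "ereal \<Rightarrow> ereal" where
  "ereal_sqrt x = (case x of ereal y \<Rightarrow> ereal (sqrt y) | PInfty \<Rightarrow> \<infinity> | MInfty \<Rightarrow> -\<infinity>)"

end

theory Submission
  imports Defs
begin

text \<open>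
  Write q for the number of ways to continue a non-backtracking walk at a vertex: k - 1 or l - 1,
  according to the side of the bipartition.  Deleting reversals turns a walk into a non-backtracking
  one, and the number N(r,m) of walks of length r that reduce to a given non-backtracking walk of
  length m depends only on r, m and the side of v: it is the number of walks of length r between two
  vertices at distance m in the biregular tree.  Hence b_r is the sum of N(r,m) a_m over m
  (walk_sum_eq_tree_walks), and the theorem becomes a statement about these coefficients.

  The functions on the tree that decay like x to the power -m in the distance m, corrected by a
  weight for the two sides, are eigenfunctions of the adjacency operator except at distance 0
  (radial_eigenfun).  The eigenvalue, called rate, is the product of
  sqrt (x + (k - 1) / x) and sqrt (x + (l - 1) / x).  It is smallest at
  x0 = ((k - 1) (l - 1)) powr (1/4), with value sqrt (k - 1) + sqrt (l - 1), and increases to the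
  right of x0.  Three comparisons with eigenfunctions determine the growth.

  For x at least 1 the eigenfunction is superharmonic, so N(r,m) is at most its value times the r-th
  power of the rate (tree_walks_le).  If x exceeds the growth of a, the sum over m converges
  geometrically and b grows at most at the rate of x (growth_le_rate).

  For x > x0 the generating function of N(r,m) at the inverse of the rate dominates the
  eigenfunction up to a constant factor (eigenfun_le_green).  If b grew more slowly than the rate of x, all
  a_m would be bounded by a multiple of x to the power m.  So b grows at least at the rate of x if
  x is smaller than the growth of a (rate_le_growth).

  Finally b always grows at least like the powers of sqrt (k - 1) + sqrt (l - 1): connectedness
  gives some m with a_m > 0, and N(r,m) is bounded below by counting walks in a long segment of
  distances, where the eigenfunctions are sines (tree_walks_ge_sine, spectral_radius_le_growth).
  The three bounds, together with the continuity of the rate, give the formula (growth_transform).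
\<close>

section \<open>Walk counts in the biregular tree\<close>

text \<open>
  The adjacency operator of the biregular tree in which vertices of the two types have
  q True + 1 and q False + 1 neighbours, restricted to functions of a vertex that depend only on
  its type t and on its distance m to a fixed target.  Neighbours have the opposite type.  At
  distance 0 all of them are further away; otherwise exactly one is closer.
\<close>
fun radial :: "(bool \<Rightarrow> real) \<Rightarrow> (bool \<Rightarrow> nat \<Rightarrow> real) \<Rightarrow> bool \<Rightarrow> nat \<Rightarrow> real" where
  "radial q g t 0 = (q t + 1) * g (\<not> t) 1"
| "radial q g t (Suc j) = g (\<not> t) j + q t * g (\<not> t) (Suc (Suc j))"

text \<open>
  The number of walks of length r in this tree from a vertex of type t to a given vertex at
  distance m.
\<close>
primrec tree_walks :: "(bool \<Rightarrow> real) \<Rightarrow> nat \<Rightarrow> bool \<Rightarrow> nat \<Rightarrow> real" where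
  "tree_walks q 0 = (\<lambda>t m. of_bool (m = 0))"
| "tree_walks q (Suc r) = radial q (tree_walks q r)"

definition rate :: "(bool \<Rightarrow> real) \<Rightarrow> real \<Rightarrow> real" where
  "rate q x = sqrt (x + q True / x) * sqrt (x + q False / x)"

text \<open>
  Up to the type-dependent weight, the function decays like x to the power -m.  The weight is
  chosen so that one step of the adjacency operator, which exchanges the types, multiplies by the
  same number rate q x at both types.
\<close>
definition eigenfun :: "(bool \<Rightarrow> real) \<Rightarrow> real \<Rightarrow> bool \<Rightarrow> nat \<Rightarrow> real" where
  "eigenfun q x t m = sqrt (x + q t / x) / x ^ m"

locale branching =
  fixes q :: "bool \<Rightarrow> real"
  assumes q_ge_1: "1 \<le> q t"
begin

lemma q_pos: "0 < q t" using q_ge_1[of t] by linarith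

lemma radial_mono:
  assumes "\<And>t m. g t m \<le> h t m"
  shows "radial q g t m \<le> radial q h t m"
  using assms q_pos[of t] by (cases m) (auto intro!: add_mono mult_left_mono)

lemma radial_cmult: "radial q (\<lambda>t m. c * g t m) t m = c * radial q g t m"
  by (cases m) (auto simp: algebra_simps)

lemma radial_add: "radial q (\<lambda>t m. g t m + h t m) t m = radial q g t m + radial q h t m"
  by (cases m) (auto simp: algebra_simps)

lemma iter_mono:
  assumes "\<And>t m. g t m \<le> h t m"
  shows "(radial q ^^ r) g t m \<le> (radial q ^^ r) h t m"
  using assms by (induction r arbitrary: t m) (auto intro!: radial_mono)

lemma iter_cmult: "(radial q ^^ r) (\<lambda>t m. c * g t m) = (\<lambda>t m. c * (radial q ^^ r) g t m)"
  by (induction r) (simp_all add: radial_cmult fun_eq_iff[of "radial q _"])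

lemma iter_add:
  "(radial q ^^ r) (\<lambda>t m. g t m + h t m) = (\<lambda>t m. (radial q ^^ r) g t m + (radial q ^^ r) h t m)"
  by (induction r) (simp_all add: radial_add fun_eq_iff[of "radial q _"])

lemma tree_walks_eq_iter: "tree_walks q r = (radial q ^^ r) (\<lambda>t m. of_bool (m = 0))"
  by (induction r) auto

lemma tree_walks_nonneg: "0 \<le> tree_walks q r t m"
  using q_pos by (induction r arbitrary: t m; (case_tac m)?) (auto simp: less_imp_le)

lemma tree_walks_eq_0: "r < m \<Longrightarrow> tree_walks q r t m = 0"
  by (induction r arbitrary: t m; (case_tac m)?) auto

section \<open>Positive eigenfunctions\<close>

lemma rate_flip: "rate q x = sqrt (x + q t / x) * sqrt (x + q (\<not> t) / x)"
  by (cases t) (auto simp: rate_def)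

lemma rate_pos: "0 < x \<Longrightarrow> 0 < rate q x"
  by (simp add: rate_def add_pos_pos q_pos)

lemma weight_ge_1: "1 \<le> x \<Longrightarrow> 1 \<le> sqrt (x + q t / x)"
  using q_pos[of t] by (simp add: add_increasing2)

lemma weight_le_rate: "1 \<le> x \<Longrightarrow> sqrt (x + q t / x) \<le> rate q x"
  using weight_ge_1[of x t] weight_ge_1[of x "\<not> t"]
  unfolding rate_flip[of x t] by (metis mult_right_le_one_le mult.right_neutral mult_left_mono order_trans zero_le_one)

text \<open>
  On the powers of 1/x alone the operator acts as the factor x + q t / x at a vertex of type t,
  which is the square of the weight at t.  Multiplied by the weight at the opposite type this is
  rate q x times the weight at t.  At distance 0 an outward neighbour takes the place of the inward
  one, which loses x - 1 / x.
\<close>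
lemma radial_eigenfun:
  assumes x: "0 < x"
  shows "radial q (eigenfun q x) t m =
    rate q x * eigenfun q x t m - of_bool (m = 0) * (sqrt (x + q (\<not> t) / x) * (x - 1 / x))"
proof -
  let ?D = "sqrt (x + q t / x)" and ?D' = "sqrt (x + q (\<not> t) / x)"
  have D: "?D * ?D = x + q t / x" using x q_pos[of t] by simp
  have *: "rate q x * ?D = ?D' * (x + q t / x)"
    using D by (metis rate_flip mult.assoc mult.commute)
  show ?thesis
  proof (cases m)
    case 0
    have "radial q (eigenfun q x) t 0 = ?D' * ((q t + 1) / x)" by (simp add: eigenfun_def)
    also have "\<dots> = ?D' * (x + q t / x) - ?D' * (x - 1 / x)"
      using x by (simp add: field_simps)
    finally show ?thesis by (simp add: 0 eigenfun_def *)
  next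
    case (Suc j)
    have "radial q (eigenfun q x) t m = ?D' * (1 / x ^ j + q t / x ^ Suc (Suc j))"
      by (simp add: Suc eigenfun_def algebra_simps)
    also have "1 / x ^ j + q t / x ^ Suc (Suc j) = (x + q t / x) / x ^ m"
      using x by (simp add: Suc field_simps)
    also have "?D' * ((x + q t / x) / x ^ m) = rate q x * eigenfun q x t m"
      unfolding eigenfun_def times_divide_eq_right * ..
    finally show ?thesis by (simp add: Suc)
  qed
qed

text \<open>
  For x at least 1 the loss at distance 0 is non-negative, so the eigenfunction is superharmonic.
\<close>
lemma iter_eigenfun_le:
  assumes x: "1 \<le> x"
  shows "(radial q ^^ r) (eigenfun q x) t m \<le> rate q x ^ r * eigenfun q x t m"
proof (induction r arbitrary: t m)
  case (Suc r)
  have "0 \<le> sqrt (x + q (\<not> t) / x) * (x - 1 / x)"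
    using x q_pos[of "\<not> t"] by (intro mult_nonneg_nonneg) (auto simp: field_simps mult_ge1_I)
  then have one: "radial q (eigenfun q x) t m \<le> rate q x * eigenfun q x t m"
    using radial_eigenfun[of x t m] x by (auto simp: of_bool_def)
  have "(radial q ^^ Suc r) (eigenfun q x) t m \<le> radial q (\<lambda>t m. rate q x ^ r * eigenfun q x t m) t m"
    using Suc by (auto intro: radial_mono)
  also have "\<dots> \<le> rate q x ^ r * (rate q x * eigenfun q x t m)"
    unfolding radial_cmult using one rate_pos[of x] x by (intro mult_left_mono) auto
  finally show ?case by (simp add: algebra_simps)
qed simp

text \<open>
  The initial condition of the walk count lies below the eigenfunction because the weights are at
  least 1, and the operator is monotone.
\<close>
lemma tree_walks_le:
  assumes x: "1 \<le> x"
  shows "tree_walks q r t m \<le> rate q x ^ r * eigenfun q x t m"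
proof -
  have "tree_walks q r t m \<le> (radial q ^^ r) (eigenfun q x) t m"
    unfolding tree_walks_eq_iter
  proof (intro iter_mono)
    fix t m
    have "0 \<le> eigenfun q x t m" using x q_pos[of t] by (simp add: eigenfun_def add_nonneg_nonneg)
    then show "of_bool (m = 0) \<le> eigenfun q x t m"
      using weight_ge_1[OF x, of t] by (cases m) (auto simp: eigenfun_def)
  qed
  then show ?thesis using iter_eigenfun_le[OF x] order_trans by blast
qed

text \<open>
  Solving the inhomogeneous eigenvalue equation for the eigenfunction and iterating it R times
  expresses the eigenfunction by the first R terms of the generating function of the walk counts at
  1 / rate q x, the source being concentrated at distance 0, and a remainder.
\<close>
lemma eigenfun_le_green_partial:
  assumes x: "1 \<le> x"
  shows "eigenfun q x t m \<le> x * (\<Sum>r<R. tree_walks q r t m / rate q x ^ r)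
           + (radial q ^^ R) (eigenfun q x) t m / rate q x ^ R"
proof (induction R)
  case (Suc R)
  let ?h = "eigenfun q x" and ?l = "rate q x"
  have l: "0 < ?l" using x by (simp add: rate_pos)
  have step: "?h t m \<le> (1 / ?l) * radial q ?h t m + x * of_bool (m = 0)" for t m
  proof -
    have "sqrt (x + q (\<not> t) / x) * (x - 1 / x) \<le> ?l * x"
      using weight_le_rate[OF x, of "\<not> t"] x l by (intro mult_mono) (auto simp: field_simps mult_ge1_I)
    then have "?l * ?h t m \<le> radial q ?h t m + ?l * (x * of_bool (m = 0))"
      using radial_eigenfun[of x t m] x by (auto simp: of_bool_def)
    then have "?l * ?h t m \<le> ?l * ((1 / ?l) * radial q ?h t m + x * of_bool (m = 0))"
      using l by (simp add: algebra_simps)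
    then show ?thesis using l mult_le_cancel_left_pos by blast
  qed
  have "(radial q ^^ R) ?h t m \<le>
      (radial q ^^ R) (\<lambda>t m. (1 / ?l) * radial q ?h t m + x * of_bool (m = 0)) t m"
    by (rule iter_mono[OF step])
  also have "\<dots> = (1 / ?l) * (radial q ^^ R) (radial q ?h) t m + x * tree_walks q R t m"
    unfolding iter_add iter_cmult tree_walks_eq_iter ..
  also have "(radial q ^^ R) (radial q ?h) = (radial q ^^ Suc R) ?h"
    by (simp add: funpow_swap1)
  finally have "(radial q ^^ R) ?h t m / ?l ^ R \<le>
      ((1 / ?l) * (radial q ^^ Suc R) ?h t m + x * tree_walks q R t m) / ?l ^ R"
    using l by (intro divide_right_mono) auto
  then show ?case using Suc by (simp add: algebra_simps add_divide_distrib)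
qed simp

text \<open>
  Hence the rate is a function of the square of x alone, smallest where that square equals
  sqrt (q True * q False).
\<close>
lemma rate_sq: "0 < x \<Longrightarrow> (rate q x)\<^sup>2 = x\<^sup>2 + q True + q False + q True * q False / x\<^sup>2"
  using q_pos[of True] q_pos[of False]
  by (simp add: rate_def power_mult_distrib add_nonneg_nonneg field_simps power2_eq_square)

lemma rate_strict_mono:
  assumes y: "0 < y" "q True * q False \<le> y ^ 4" and "y < x"
  shows "rate q y < rate q x"
proof -
  let ?Q = "q True * q False"
  have yx: "y\<^sup>2 < x\<^sup>2" using assms by (simp add: power_strict_mono)
  have y0: "0 < y\<^sup>2" and x0: "0 < x\<^sup>2" using assms by auto
  have "y ^ 4 = y\<^sup>2 * y\<^sup>2" by algebra
  also have "\<dots> < y\<^sup>2 * x\<^sup>2" using yx y0 by (intro mult_strict_left_mono)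
  finally have Q: "?Q < y\<^sup>2 * x\<^sup>2" using y by linarith
  have "?Q / y\<^sup>2 - ?Q / x\<^sup>2 = ?Q * (x\<^sup>2 - y\<^sup>2) / (y\<^sup>2 * x\<^sup>2)"
    using y0 x0 by (simp add: field_simps)
  also have "\<dots> < (y\<^sup>2 * x\<^sup>2) * (x\<^sup>2 - y\<^sup>2) / (y\<^sup>2 * x\<^sup>2)"
    using y0 x0 yx Q by (intro divide_strict_right_mono mult_strict_right_mono) auto
  also have "\<dots> = x\<^sup>2 - y\<^sup>2" using y0 x0 by (intro nonzero_mult_div_cancel_left) simp
  finally have "(rate q y)\<^sup>2 < (rate q x)\<^sup>2"
    using assms by (subst (1 2) rate_sq) auto
  then show ?thesis using rate_pos[of x] assms by (meson less_imp_le order_less_trans power_less_imp_less_base)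
qed

text \<open>
  The remainder of the preceding expansion vanishes in the limit: to the right of the minimum of
  the rate, the eigenfunction for x is at most a constant times the one for a smaller y, which the
  iterates expand only at the smaller rate of y.  So the generating function of the walk counts,
  up to the factor x, dominates the eigenfunction.
\<close>
lemma eigenfun_le_green:
  assumes y: "1 \<le> y" "q True * q False \<le> y ^ 4" and yx: "y < x"
    and B: "\<And>R. (\<Sum>r<R. tree_walks q r t m / rate q x ^ r) \<le> B"
  shows "eigenfun q x t m \<le> x * B"
proof -
  let ?l = "rate q x"
  have x: "1 \<le> x" using y yx by simp
  have l: "0 < ?l" "0 < rate q y" using x y by (simp_all add: rate_pos)
  \<comment> \<open>Since all weights are at least 1, each weight is at most their product, which is the rate.\<close>
  have comp: "eigenfun q x t m \<le> ?l * eigenfun q y t m" for t m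
  proof -
    have "eigenfun q x t m \<le> ?l / y ^ m"
      unfolding eigenfun_def using weight_le_rate[OF x, of t] y yx l
      by (intro frac_le power_mono) auto
    also have "\<dots> \<le> ?l * eigenfun q y t m"
      using weight_ge_1[of y t] y l by (simp add: eigenfun_def field_simps)
    finally show ?thesis .
  qed
  have le: "eigenfun q x t m \<le> x * B + (rate q y / ?l) ^ R * (?l * eigenfun q y t m)" for R
  proof -
    have "(radial q ^^ R) (eigenfun q x) t m \<le> (radial q ^^ R) (\<lambda>t m. ?l * eigenfun q y t m) t m"
      by (rule iter_mono[OF comp])
    also have "\<dots> \<le> ?l * (rate q y ^ R * eigenfun q y t m)"
      unfolding iter_cmult using l y by (intro mult_left_mono iter_eigenfun_le) auto
    finally have "(radial q ^^ R) (eigenfun q x) t m / ?l ^ R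
        \<le> ?l * (rate q y ^ R * eigenfun q y t m) / ?l ^ R"
      using l by (intro divide_right_mono) auto
    also have "\<dots> = (rate q y / ?l) ^ R * (?l * eigenfun q y t m)"
      by (simp add: power_divide)
    moreover have "x * (\<Sum>r<R. tree_walks q r t m / ?l ^ r) \<le> x * B"
      using B[of R] x by (intro mult_left_mono) auto
    ultimately show ?thesis using eigenfun_le_green_partial[OF x, of t m R] by linarith
  qed
  have "rate q y / ?l < 1" using rate_strict_mono[of y x] y yx l by simp
  moreover have "0 \<le> rate q y / ?l" using l by simp
  ultimately have "(\<lambda>R. (rate q y / ?l) ^ R) \<longlonglongrightarrow> 0" by (metis LIMSEQ_realpow_zero)
  then have "(\<lambda>R. x * B + (rate q y / ?l) ^ R * (?l * eigenfun q y t m)) \<longlonglongrightarrow> x * B + 0 * (?l * eigenfun q y t m)"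
    by (intro tendsto_add tendsto_const tendsto_mult_right)
  then show ?thesis using le by (intro LIMSEQ_le_const[where X="\<lambda>R. x * B + (rate q y / ?l) ^ R * (?l * eigenfun q y t m)"]) auto
qed

section \<open>Walks confined to a segment\<close>

text \<open>
  Two steps preserve the type, so away from distance 0 the recursion has constant coefficients.
\<close>
lemma tree_walks_two_steps:
  "tree_walks q (Suc (Suc r)) t (Suc (Suc j)) = tree_walks q r t j
     + (q True + q False) * tree_walks q r t (Suc (Suc j))
     + q True * q False * tree_walks q r t (Suc (Suc (Suc (Suc j))))"
  by (cases t) (auto simp: algebra_simps)

lemma tree_walks_outward: "tree_walks q r (\<not> t) j \<le> tree_walks q (Suc r) t (Suc j)"
  using tree_walks_nonneg q_pos[of t] by simp

lemma tree_walks_inward: "tree_walks q r (\<not> t) (Suc j) \<le> tree_walks q (Suc r) t j"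
proof -
  have "1 * tree_walks q r (\<not> t) (Suc j) \<le> q t * tree_walks q r (\<not> t) (Suc j)"
    using q_ge_1 tree_walks_nonneg by (intro mult_right_mono)
  then show ?thesis
    using tree_walks_nonneg[of r "\<not> t" "j - 1"] tree_walks_nonneg[of r "\<not> t" "Suc j"]
    by (cases j) (auto simp: distrib_right)
qed

lemma tree_walks_even_ge_1: "i \<le> n \<Longrightarrow> 1 \<le> tree_walks q (2 * n) t (2 * i)"
proof (induction n arbitrary: i)
  case (Suc n)
  show ?case
  proof (cases i)
    case 0
    show ?thesis using Suc.IH[of 0] tree_walks_outward[of "2 * n" "\<not> t" 0] tree_walks_inward[of "Suc (2 * n)" t 0]
      by (simp add: 0 del: tree_walks.simps)
  next
    case (Suc i')
    show ?thesis using Suc.IH[of i'] Suc.prems Suc tree_walks_outward[of "2 * n" "\<not> t" "2*i'"] tree_walks_outward[of "Suc (2 * n)" t "Suc (2 * i')"]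
      by (simp add: del: tree_walks.simps)
  qed
qed simp

text \<open>
  Conjugation by the powers of p turns the two-step recursion into a symmetric one, with sines as
  eigenfunctions on a segment.  Since the sine vanishes at both ends of the segment, walks that leave
  it may be discarded.  The comparison starts after 2 L steps, when every vertex at even distance up
  to 2 L has been reached.
\<close>
lemma tree_walks_ge_sine:
  fixes L :: nat
  defines "\<theta> \<equiv> pi / L" and "p \<equiv> sqrt (q True * q False)"
  defines "\<mu> \<equiv> q True + q False + 2 * p * cos \<theta>"
  assumes L: "2 \<le> L" and i: "i \<le> L"
  shows "\<mu> ^ n * (sin (i * \<theta>) / p ^ i) \<le> tree_walks q (2 * (L + n)) t (2 * i)"
  using i
proof (induction n arbitrary: i)
  have "1 \<le> q True * q False" using mult_mono[of 1 "q True" 1 "q False"] q_ge_1 q_pos[of True] by simp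
  then have p: "1 \<le> p" "p * p = q True * q False" by (auto simp: p_def)
  {
    case 0
    have "sin (i * \<theta>) / p ^ i \<le> 1 / 1" using p by (intro frac_le) auto
    then show ?case using tree_walks_even_ge_1[of i L t] 0 by simp
  next
    case (Suc n)
    consider "i = 0" | "i = L" | j where "i = Suc j" "i < L" using Suc.prems by (cases i) fastforce+
    then show ?case
    proof cases
      case 1
      then show ?thesis using tree_walks_nonneg[of "2 * (L + Suc n)" t 0] by (simp del: tree_walks.simps)
    next
      case 2
      then show ?thesis using tree_walks_nonneg[of "2 * (L + Suc n)" t "2 * i"] L
        by (simp add: \<theta>_def del: tree_walks.simps)
    next
      case 3
      let ?r = "2 * (L + n)"
      let ?s = "\<lambda>i::nat. \<mu> ^ n * (sin (i * \<theta>) / p ^ i)"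
      have sines: "sin (j * \<theta>) + sin (Suc i * \<theta>) = 2 * cos \<theta> * sin (i * \<theta>)"
        using sin_add[of "i * \<theta>" \<theta>] sin_diff[of "i * \<theta>" \<theta>] by (simp add: 3 algebra_simps)
      have "\<mu> ^ Suc n * (sin (i * \<theta>) / p ^ i)
          = \<mu> ^ n / p ^ i * ((q True + q False) * sin (i * \<theta>) + p * (2 * cos \<theta> * sin (i * \<theta>)))"
        by (simp add: \<mu>_def field_simps)
      also have "\<dots> = ?s j + (q True + q False) * ?s i + q True * q False * ?s (Suc i)"
        unfolding sines[symmetric] p(2)[symmetric] using p(1) by (simp add: 3 field_simps)
      also have "\<dots> \<le> tree_walks q ?r t (2 * j) + (q True + q False) * tree_walks q ?r t (2 * i)
          + q True * q False * tree_walks q ?r t (2 * Suc i)"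
        using 3 q_pos by (intro add_mono mult_left_mono Suc.IH) (auto simp: less_imp_le add_nonneg_nonneg)
      also have "\<dots> = tree_walks q (2 * (L + Suc n)) t (2 * i)"
        using tree_walks_two_steps[of ?r t "2 * j"] by (simp add: 3 del: tree_walks.simps)
      finally show ?thesis .
    qed
  }
qed

text \<open>
  The steps that increase the distance from j to j + m alternate the type; t' is t or its
  negation according to the parity of m.
\<close>
lemma tree_walks_lift: "\<exists>t'. \<forall>r. tree_walks q r t' j \<le> tree_walks q (r + m) t (j + m)"
proof (induction m arbitrary: t)
  case (Suc m)
  then obtain t' where "tree_walks q r t' j \<le> tree_walks q (r + m) (\<not> t) (j + m)" for r by blast
  then show ?case using tree_walks_outward[of _ t] by (metis add_Suc_right order_trans)
qed auto

text \<open>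
  The sine bound at distance 2 carries over to every distance m: m extra steps lead from distance 2
  to distance m + 2, and two more lead back to m.  For large L the base approaches
  the square of sqrt (q True) + sqrt (q False).
\<close>
lemma tree_walks_ge_exponential:
  fixes L :: nat
  assumes L: "2 \<le> L"
  defines "\<mu> \<equiv> q True + q False + 2 * sqrt (q True * q False) * cos (pi / L)"
  shows "\<exists>c>0. \<exists>r0. \<forall>n. c * \<mu> ^ n \<le> tree_walks q (2 * n + r0) t m"
proof -
  have Q: "0 < q True * q False" by (simp add: q_pos)
  define c where "c = sin (pi / L) / sqrt (q True * q False)"
  have "pi / L < pi" using L by (simp add: field_simps)
  then have c: "0 < c" using L Q by (auto simp: c_def intro!: divide_pos_pos sin_gt_zero)
  obtain t' where t': "tree_walks q r t' 2 \<le> tree_walks q (r + m) t (2 + m)" for r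
    using tree_walks_lift[of 2 m t] by blast
  have "c * \<mu> ^ n \<le> tree_walks q (2 * n + (2 * L + m + 2)) t m" for n
  proof -
    have "c * \<mu> ^ n \<le> tree_walks q (2 * (L + n)) t' 2"
      using tree_walks_ge_sine[OF L, of 1 n t'] L by (simp add: c_def \<mu>_def mult.commute)
    also have "\<dots> \<le> tree_walks q (2 * (L + n) + m) t (Suc (Suc m))" using t' by simp
    also have "\<dots> \<le> tree_walks q (Suc (2 * (L + n) + m)) (\<not> t) (Suc m)"
      using tree_walks_inward[of _ "\<not> t"] by (simp del: tree_walks.simps)
    also have "\<dots> \<le> tree_walks q (Suc (Suc (2 * (L + n) + m))) t m"
      using tree_walks_inward by blast
    finally show ?thesis by (simp add: algebra_simps del: tree_walks.simps)
  qed
  then show ?thesis using c by blast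
qed

end

section \<open>Exponential growth rates\<close>

abbreviation growth :: "(nat \<Rightarrow> real) \<Rightarrow> ereal" where
  "growth b \<equiv> limsup (\<lambda>r. ereal (root r (b r)))"

lemma growth_le:
  assumes \<mu>: "0 < \<mu>" and b: "\<And>r. b r \<le> C * \<mu> ^ r"
  shows "growth b \<le> ereal \<mu>"
proof -
  define C' where "C' = max C 1"
  \<comment> \<open>A positive constant is needed for its roots to tend to 1.\<close>
  have "root r (b r) \<le> root r C' * \<mu>" if "0 < r" for r
  proof -
    have "b r \<le> C * \<mu> ^ r" by (rule b)
    also have "\<dots> \<le> C' * \<mu> ^ r" using \<mu> by (intro mult_right_mono) (auto simp: C'_def)
    finally have "b r \<le> C' * \<mu> ^ r" .
    then have "root r (b r) \<le> root r (C' * \<mu> ^ r)" using that by simp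
    also have "\<dots> = root r C' * \<mu>" using that \<mu> by (simp add: real_root_mult real_root_power_cancel)
    finally show ?thesis .
  qed
  then have "growth b \<le> limsup (\<lambda>r. ereal (root r C' * \<mu>))"
    by (intro Limsup_mono eventually_mono[OF eventually_gt_at_top[of 0]]) auto
  also have "\<dots> = ereal (1 * \<mu>)"
    using LIMSEQ_root_const[of C'] by (intro lim_imp_Limsup tendsto_intros) (auto simp: C'_def)
  finally show ?thesis by simp
qed

lemma growth_less_bound:
  assumes lt: "growth b < ereal \<mu>" and \<mu>: "0 < \<mu>" and b0: "\<And>r. 0 \<le> b r"
  obtains C where "0 < C" "\<And>r. b r \<le> C * \<mu> ^ r"
proof -
  have "\<forall>\<^sub>F r in sequentially. ereal (root r (b r)) < ereal \<mu>"
    using lt by (rule Limsup_lessD)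
  then obtain n where n: "\<And>r. n \<le> r \<Longrightarrow> root r (b r) < \<mu>"
    by (auto simp: eventually_sequentially)
  define C where "C = 1 + (\<Sum>r\<le>n. b r / \<mu> ^ r)"
  have pos: "0 \<le> (\<Sum>r\<le>n. b r / \<mu> ^ r)" using b0 \<mu> by (intro sum_nonneg) auto
  have "b r \<le> C * \<mu> ^ r" for r
  proof (cases "r \<le> n")
    case True
    have "b r / \<mu> ^ r \<le> (\<Sum>r\<le>n. b r / \<mu> ^ r)" using b0 \<mu> True by (intro member_le_sum) auto
    then have "b r / \<mu> ^ r \<le> C" by (simp add: C_def)
    then show ?thesis using \<mu> by (simp add: field_simps)
  next
    case False
    then have r: "0 < r" "n \<le> r" by auto
    have "b r = root r (b r) ^ r" using r b0 by simp
    also have "\<dots> \<le> \<mu> ^ r" using n[OF r(2)] b0 r by (intro power_mono) auto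
    also have "\<dots> \<le> C * \<mu> ^ r" using \<mu> pos by (simp add: C_def)
    finally show ?thesis .
  qed
  moreover have "0 < C" using pos by (simp add: C_def)
  ultimately show ?thesis using that by blast
qed

lemma growth_nonneg:
  assumes "\<And>r. 0 \<le> b r"
  shows "0 \<le> growth b"
proof -
  have "limsup (\<lambda>r. ereal 0) \<le> growth b"
    using assms by (intro Limsup_mono always_eventually allI)
      (simp add: real_root_pos_pos_le)
  then show ?thesis by (simp add: Limsup_const zero_ereal_def)
qed

lemma ereal_less_realE:
  assumes "0 \<le> X" "X < ereal x"
  obtains y where "X < ereal y" "0 < y" "y < x"
proof -
  obtain w where w: "X = ereal w" using assms by (cases X) auto
  show ?thesis using assms dense[of w x] that by (auto simp: w zero_ereal_def)
qed

section \<open>Transfer of growth rates\<close>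

context branching
begin

text \<open>
  With a growing strictly slower than the powers of x, the bound on the walk counts by the
  eigenfunction makes the sum over m a convergent geometric series.
\<close>
lemma growth_le_rate:
  assumes a: "\<And>m. 0 \<le> a m" and b: "\<And>r. b r = (\<Sum>m\<le>r. tree_walks q r t m * a m)"
    and x: "1 \<le> x" and lt: "growth a < ereal x"
  shows "growth b \<le> ereal (rate q x)"
proof -
  have "0 \<le> growth a" using growth_nonneg a by blast
  then obtain y where y: "growth a < ereal y" "0 < y" "y < x"
    using lt by (rule ereal_less_realE)
  obtain C where C: "0 < C" "\<And>m. a m \<le> C * y ^ m"
    using growth_less_bound[OF y(1,2) a] by blast
  let ?D = "sqrt (x + q t / x)"
  have yx: "0 \<le> y / x" "y / x < 1" using y x by auto
  have "b r \<le> (?D * C * (1 / (1 - y / x))) * rate q x ^ r" for r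
  proof -
    have "tree_walks q r t m * a m \<le> (rate q x ^ r * ?D * C) * (y / x) ^ m" for m
    proof -
      have "tree_walks q r t m * a m \<le> (rate q x ^ r * eigenfun q x t m) * (C * y ^ m)"
        using tree_walks_le[OF x, of r t m] tree_walks_nonneg[of r t m] C(2)[of m] a[of m]
        by (intro mult_mono) linarith+
      then show ?thesis by (simp add: eigenfun_def power_divide mult.assoc)
    qed
    then have "b r \<le> (\<Sum>m\<le>r. (rate q x ^ r * ?D * C) * (y / x) ^ m)"
      unfolding b by (rule sum_mono)
    also have "\<dots> = (rate q x ^ r * ?D * C) * (\<Sum>m<Suc r. (y / x) ^ m)"
      by (simp add: sum_distrib_left lessThan_Suc_atMost)
    also have "\<dots> \<le> (rate q x ^ r * ?D * C) * (1 / (1 - y / x))"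
    proof (intro mult_left_mono)
      have "(\<Sum>m<Suc r. (y / x) ^ m) = (1 - (y / x) ^ Suc r) / (1 - y / x)"
        using yx by (subst sum_gp_strict) auto
      then show "(\<Sum>m<Suc r. (y / x) ^ m) \<le> 1 / (1 - y / x)"
        using yx zero_le_power[OF yx(1), of "Suc r"]
        by (simp only:) (intro divide_right_mono; linarith)
      show "0 \<le> rate q x ^ r * ?D * C"
        using x C rate_pos[of x] q_pos[of t] by (intro mult_nonneg_nonneg) (auto simp: add_nonneg_nonneg)
    qed
    finally show ?thesis by (simp only: mult_ac)
  qed
  moreover have "0 < rate q x" using x by (intro rate_pos) simp
  ultimately show ?thesis using growth_le by blast
qed

text \<open>
  If b grew more slowly than the powers of rate q x, then its generating function would be finite at
  1 / rate q x.  Each single m contributes a m times the generating function of the walk counts,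
  hence at least a constant times a m times the eigenfunction, so that a m would be bounded by a multiple of x to the
  power m, contrary to the growth of a.
\<close>
lemma rate_le_growth:
  assumes a: "\<And>m. 0 \<le> a m" and b: "\<And>r. b r = (\<Sum>m\<le>r. tree_walks q r t m * a m)"
    and y: "1 \<le> y" "q True * q False \<le> y ^ 4" and yx: "y < x" and lt: "ereal x < growth a"
  shows "ereal (rate q x) \<le> growth b"
proof (rule ccontr)
  have x: "1 \<le> x" "0 < x" using y yx by auto
  have l: "0 < rate q x" using x rate_pos by blast
  assume "\<not> ereal (rate q x) \<le> growth b"
  then have "growth b < ereal (rate q x)" by simp
  have b0: "0 \<le> b r" for r unfolding b using a tree_walks_nonneg by (intro sum_nonneg) auto
  then have "0 \<le> growth b" using growth_nonneg by blast
  then obtain \<mu> where \<mu>: "growth b < ereal \<mu>" "0 < \<mu>" "\<mu> < rate q x"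
    using \<open>growth b < _\<close> by (rule ereal_less_realE)
  obtain C where C: "0 < C" "\<And>m. b m \<le> C * \<mu> ^ m"
    using growth_less_bound[OF \<mu>(1,2) b0] by blast
  define z where "z = \<mu> / rate q x"
  have z: "0 \<le> z" "z < 1" using \<mu> l by (auto simp: z_def)
  define B where "B = C * (1 / (1 - z))"
  have "a m \<le> (x * B) * x ^ m" for m
  proof (cases "a m = 0")
    case True
    then show ?thesis using x C z by (simp add: B_def)
  next
    case False
    then have am: "0 < a m" using a[of m] by simp
    have "(\<Sum>r<R. tree_walks q r t m / rate q x ^ r) \<le> B / a m" for R
    proof -
      have "a m * (tree_walks q r t m / rate q x ^ r) \<le> C * z ^ r" for r
      proof -
        have "tree_walks q r t m * a m \<le> b r"
        proof (cases "m \<le> r")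
          case True
          then show ?thesis unfolding b using a tree_walks_nonneg
            by (intro member_le_sum[of m "{..r}" "\<lambda>m. tree_walks q r t m * a m"]) auto
        qed (use b0 in \<open>simp add: tree_walks_eq_0\<close>)
        also have "\<dots> \<le> C * \<mu> ^ r" by (rule C)
        finally show ?thesis using l by (simp add: z_def power_divide field_simps)
      qed
      then have "(\<Sum>r<R. a m * (tree_walks q r t m / rate q x ^ r)) \<le> (\<Sum>r<R. C * z ^ r)"
        by (rule sum_mono)
      also have "\<dots> = C * (\<Sum>r<R. z ^ r)" by (simp add: sum_distrib_left)
      also have "\<dots> \<le> B"
        unfolding B_def using C z by (intro mult_left_mono) (auto simp: sum_gp_strict divide_right_mono)
      finally show ?thesis using am by (simp only: pos_le_divide_eq mult.commute flip: sum_distrib_left)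
    qed
    then have "eigenfun q x t m \<le> x * (B / a m)" by (rule eigenfun_le_green[OF y yx])
    moreover have "1 / x ^ m \<le> eigenfun q x t m"
      unfolding eigenfun_def using weight_ge_1[OF x(1), of t] x by (intro divide_right_mono) auto
    ultimately have "1 / x ^ m \<le> x * B / a m" by simp
    then show ?thesis using am x by (simp add: field_simps)
  qed
  then have "growth a \<le> ereal x" using x by (intro growth_le)
  then show False using lt by simp
qed

text \<open>
  A single m with a m > 0 contributes a positive multiple of the walk counts to distance m, and
  their growth has lower bounds arbitrarily close to the spectral radius.
\<close>
lemma spectral_radius_le_growth:
  assumes a: "\<And>m. 0 \<le> a m" and b: "\<And>r. b r = (\<Sum>m\<le>r. tree_walks q r t m * a m)"
    and pos: "0 < a m"
  shows "ereal (sqrt (q True) + sqrt (q False)) \<le> growth b"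
proof (rule ccontr)
  let ?\<rho> = "sqrt (q True) + sqrt (q False)"
  assume "\<not> ereal ?\<rho> \<le> growth b"
  then have "growth b < ereal ?\<rho>" by simp
  have b0: "0 \<le> b r" for r unfolding b using a tree_walks_nonneg by (intro sum_nonneg) auto
  then have "0 \<le> growth b" using growth_nonneg by blast
  then obtain \<nu> where \<nu>: "growth b < ereal \<nu>" "0 < \<nu>" "\<nu> < ?\<rho>"
    using \<open>growth b < _\<close> by (rule ereal_less_realE)
  obtain C where C: "0 < C" "\<And>m. b m \<le> C * \<nu> ^ m"
    using growth_less_bound[OF \<nu>(1,2) b0] by blast
  define \<mu> where "\<mu> L = q True + q False + 2 * sqrt (q True * q False) * cos (pi / real L)" for L
  have "(\<lambda>L. pi * inverse (real L)) \<longlonglongrightarrow> pi * 0"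
    by (intro tendsto_intros lim_inverse_n)
  then have "(\<lambda>L. pi / real L) \<longlonglongrightarrow> 0" by (simp add: field_simps)
  then have "\<mu> \<longlonglongrightarrow> q True + q False + 2 * sqrt (q True * q False) * cos 0"
    unfolding \<mu>_def by (intro tendsto_intros)
  also have "q True + q False + 2 * sqrt (q True * q False) * cos 0 = ?\<rho>\<^sup>2"
    using q_pos[of True] q_pos[of False] by (simp add: power2_sum real_sqrt_mult)
  finally have lim: "\<mu> \<longlonglongrightarrow> ?\<rho>\<^sup>2" .
  have "\<nu>\<^sup>2 < ?\<rho>\<^sup>2" using \<nu> by (intro power_strict_mono) auto
  then have "\<forall>\<^sub>F L in sequentially. \<nu>\<^sup>2 < \<mu> L \<and> 2 \<le> L"
    using order_tendstoD(1)[OF lim] eventually_ge_at_top[of 2] by (intro eventually_conj) auto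
  then obtain L where L: "\<nu>\<^sup>2 < \<mu> L" "2 \<le> L" by (auto dest: eventually_happens)
  obtain c r0 where c: "0 < c" "\<And>n. c * \<mu> L ^ n \<le> tree_walks q (2 * n + r0) t m"
    using tree_walks_ge_exponential[OF L(2), of t m] unfolding \<mu>_def by blast
  have bound: "(\<mu> L / \<nu>\<^sup>2) ^ n \<le> C * \<nu> ^ r0 / (c * a m)" for n
  proof -
    have "a m * (c * \<mu> L ^ n) \<le> a m * tree_walks q (2 * n + r0) t m"
      using c pos by (intro mult_left_mono) auto
    also have "\<dots> \<le> b (2 * n + r0)"
    proof (cases "m \<le> 2 * n + r0")
      case True
      then show ?thesis unfolding b using a tree_walks_nonneg
        by (subst mult.commute, intro member_le_sum[of m _ "\<lambda>m. tree_walks q (2 * n + r0) t m * a m"]) auto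
    qed (use b0 in \<open>simp add: tree_walks_eq_0\<close>)
    also have "\<dots> \<le> C * \<nu> ^ (2 * n + r0)" by (rule C)
    also have "\<dots> = C * \<nu> ^ r0 * (\<nu>\<^sup>2) ^ n"
      unfolding power_add power_mult by simp
    finally have "a m * c * \<mu> L ^ n \<le> C * \<nu> ^ r0 * (\<nu>\<^sup>2) ^ n"
      by simp
    then show ?thesis using c pos \<nu> by (simp add: power_divide field_simps)
  qed
  obtain n where "C * \<nu> ^ r0 / (c * a m) < (\<mu> L / \<nu>\<^sup>2) ^ n"
    using real_arch_pow[of "\<mu> L / \<nu>\<^sup>2"] L \<nu> by auto
  then show False using bound[of n] by simp
qed

lemma rate_tendsto: "0 < x \<Longrightarrow> (rate q \<longlongrightarrow> rate q x) (at x within S)"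
  unfolding rate_def by (intro tendsto_intros) auto

text \<open>
  This x is the point where the rate is smallest, and the minimum is the spectral radius of the
  tree.
\<close>
lemma rate_at_4th_root:
  assumes "0 < x" "x ^ 4 = q True * q False"
  shows "rate q x = sqrt (q True) + sqrt (q False)"
proof -
  have x2: "x\<^sup>2 = sqrt (q True) * sqrt (q False)"
  proof -
    have "x ^ 4 = x\<^sup>2 * x\<^sup>2" by algebra
    then have "sqrt (q True * q False) = x\<^sup>2" by (simp only: assms(2)[symmetric] real_sqrt_mult_self abs_power2 real_sqrt_mult)
    then show ?thesis by (simp add: real_sqrt_mult)
  qed
  have "q True * q False / x\<^sup>2 = x\<^sup>2"
    unfolding assms(2)[symmetric] using assms(1) by (simp add: field_simps flip: power_add)
  then have "(rate q x)\<^sup>2 = (sqrt (q True) + sqrt (q False))\<^sup>2"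
    using assms q_pos[of True] q_pos[of False] by (simp add: rate_sq power2_sum x2)
  then show ?thesis using rate_pos[of x] assms q_pos[of True] q_pos[of False]
    by (simp add: power2_eq_iff_nonneg less_imp_le)
qed

text \<open>
  The dichotomy for abstract sequences.  The upper and lower bounds above hold for numbers strictly
  larger or strictly smaller than the growth of a; continuity of the rate closes the gap.  Below the
  minimum point x0 of the rate the upper bound is best at x0 itself, where it meets the lower bound
  by the spectral radius.
\<close>
theorem growth_transform:
  assumes a: "\<And>m. 0 \<le> a m" and b: "\<And>r. b r = (\<Sum>m\<le>r. tree_walks q r t m * a m)"
    and pos: "0 < a m" and x0: "0 < x0" "x0 ^ 4 = q True * q False"
  shows "growth a \<le> ereal x0 \<Longrightarrow> growth b = ereal (sqrt (q True) + sqrt (q False))"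
    and "growth a = ereal x \<Longrightarrow> x0 \<le> x \<Longrightarrow> growth b = ereal (rate q x)"
    and "growth a = \<infinity> \<Longrightarrow> growth b = \<infinity>"
proof -
  let ?\<rho> = "sqrt (q True) + sqrt (q False)"
  have "1 \<le> q True * q False" using mult_mono[of 1 "q True" 1 "q False"] q_ge_1 q_pos[of True] by simp
  then have x01: "1 \<le> x0" using x0 power_less_one_iff[of x0 4] by simp
  have upper: "growth b \<le> ereal (rate q x)" if "growth a \<le> ereal x" "1 \<le> x" for x
  proof (rule tendsto_lowerbound)
    show "((\<lambda>y. ereal (rate q y)) \<longlongrightarrow> ereal (rate q x)) (at_right x)"
      using that by (intro tendsto_intros rate_tendsto) auto
    show "\<forall>\<^sub>F y in at_right x. growth b \<le> ereal (rate q y)"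
      using eventually_at_right_less[of x]
    proof eventually_elim
      case (elim y)
      then have "growth a < ereal y" using that by (metis less_ereal.simps(1) order_le_less_trans)
      then show ?case using growth_le_rate[OF a b] elim that by auto
    qed
  qed simp
  have lower: "ereal (rate q x) \<le> growth b" if "ereal x < growth a" "x0 < x" for x
    using rate_le_growth[OF a b x01] x0 that by auto
  have \<rho>: "ereal ?\<rho> \<le> growth b" by (rule spectral_radius_le_growth[OF a b pos])
  show "growth b = ereal ?\<rho>" if "growth a \<le> ereal x0"
    using upper[OF that x01] \<rho> rate_at_4th_root[OF x0] by (auto intro: antisym)
  then show "growth b = ereal (rate q x)" if x: "growth a = ereal x" "x0 \<le> x"
  proof (cases "x = x0")
    case False
    then have less: "x0 < x" using x by simp
    have "ereal (rate q x) \<le> growth b"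
    proof (rule tendsto_upperbound)
      show "((\<lambda>y. ereal (rate q y)) \<longlongrightarrow> ereal (rate q x)) (at_left x)"
        using x x0 by (intro tendsto_intros rate_tendsto) auto
      show "\<forall>\<^sub>F y in at_left x. ereal (rate q y) \<le> growth b"
        using eventually_at_left_real[OF less] by eventually_elim (use x in \<open>auto intro: lower\<close>)
    qed simp
    then show ?thesis using upper[of x] x x01 by (intro antisym) auto
  qed (use rate_at_4th_root[OF x0] x in auto)
  show "growth b = \<infinity>" if "growth a = \<infinity>"
  proof (rule ereal_top)
    fix B :: real
    define x where "x = max B (x0 + 1)"
    have x: "x0 < x" "B \<le> x" by (auto simp: x_def)
    \<comment> \<open>The rate is unbounded because each of its two factors is at least the square root of x.\<close>
    have "sqrt x * sqrt x \<le> rate q x"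
      unfolding rate_def using x x0 q_pos by (intro mult_mono) (auto simp: less_imp_le)
    then have "B \<le> rate q x" using x x0 by simp
    then show "ereal B \<le> growth b" using lower[of x] x that order_trans[of "ereal B" "ereal (rate q x)"] by simp
  qed
qed

end

section \<open>Walks in biregular graphs\<close>

lemma (in wf_digraph) walks_0: "v \<in> verts G \<Longrightarrow> walks G v 0 = {[]}"
  by (auto simp: walks_def awalk_Nil_iff)

lemma (in wf_digraph) walks_Suc:
  "walks G v (Suc r) = (\<Union>e\<in>out_arcs G v. (#) e ` walks G (head G e) r)"
  by (auto simp: walks_def length_Suc_conv awalk_Cons_iff image_iff)

lemma (in wf_digraph) sum_walks_Suc:
  assumes "finite (out_arcs G v)" "\<And>e. e \<in> out_arcs G v \<Longrightarrow> finite (walks G (head G e) r)"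
  shows "sum g (walks G v (Suc r)) = (\<Sum>e\<in>out_arcs G v. \<Sum>p\<in>walks G (head G e) r. g (e # p))"
  unfolding walks_Suc
  by (subst sum.UNION_disjoint) (use assms in \<open>auto simp: sum.reindex o_def\<close>)

text \<open>
  The sum of f over the end points of the non-backtracking walks of length m that can follow the arc
  e.  Fixing the preceding arc gives a recursion that does not refer to lists of arcs.
\<close>
fun nb_sum_after :: "('v, 'e) pre_digraph \<Rightarrow> ('e \<Rightarrow> 'e) \<Rightarrow> ('v \<Rightarrow> real) \<Rightarrow> nat \<Rightarrow> 'e \<Rightarrow> real" where
  "nb_sum_after G arev f 0 e = f (head G e)"
| "nb_sum_after G arev f (Suc m) e =
    (\<Sum>e' \<in> out_arcs G (head G e) - {arev e}. nb_sum_after G arev f m e')"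

text \<open>
  The colour of a vertex tells on which side of the bipartition it lies, and plays the part of the
  type of a vertex of the tree.
\<close>
locale biregular_graph = bidirected_digraph G arev + branching q
  for G :: "('v, 'e) pre_digraph" and arev :: "'e \<Rightarrow> 'e" and q :: "bool \<Rightarrow> real" +
  fixes color :: "'v \<Rightarrow> bool"
  assumes color_head: "e \<in> arcs G \<Longrightarrow> color (head G e) = (\<not> color (tail G e))"
    and finite_out: "v \<in> verts G \<Longrightarrow> finite (out_arcs G v)"
    and degree: "v \<in> verts G \<Longrightarrow> real (out_degree G v) = q (color v) + 1"
begin

lemma finite_walks: "v \<in> verts G \<Longrightarrow> finite (walks G v r)"
  by (induction r arbitrary: v) (auto simp: walks_0 walks_Suc intro!: finite_out)

lemma walk_sum_0: "v \<in> verts G \<Longrightarrow> walk_sum G v f 0 = f v"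
  by (simp add: walk_sum_def walks_0)

lemma walk_sum_Suc:
  assumes v: "v \<in> verts G"
  shows "walk_sum G v f (Suc r) = (\<Sum>e\<in>out_arcs G v. walk_sum G (head G e) f r)"
  unfolding walk_sum_def
  by (subst sum_walks_Suc) (auto intro: finite_walks finite_out v)

lemma sum_nb_walks_after:
  assumes "e \<in> arcs G"
  shows "(\<Sum>p \<in> {p \<in> walks G (head G e) m. successively (\<lambda>e e'. e' \<noteq> arev e) (e # p)}. f (awlast (head G e) p))
       = nb_sum_after G arev f m e"
  using assms
proof (induction m arbitrary: e)
  case 0
  then have *: "{p \<in> walks G (head G e) 0. successively (\<lambda>e e'. e' \<noteq> arev e) (e # p)} = {[]}"
    by (auto simp: walks_0)
  show ?case unfolding * by simp
next
  case (Suc m)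
  let ?ok = "successively (\<lambda>e e'. e' \<noteq> arev e)"
  let ?h = "head G e"
  have h: "?h \<in> verts G" using Suc.prems by simp
  have "(\<Sum>p \<in> {p \<in> walks G ?h (Suc m). ?ok (e # p)}. f (awlast ?h p))
      = (\<Sum>p \<in> walks G ?h (Suc m). if ?ok (e # p) then f (awlast ?h p) else 0)"
    using finite_walks[OF h] by (intro sum.inter_filter)
  also have "\<dots> = (\<Sum>e'\<in>out_arcs G ?h. \<Sum>p\<in>walks G (head G e') m.
      if ?ok (e # e' # p) then f (awlast (head G e') p) else 0)"
    by (subst sum_walks_Suc) (auto intro: finite_walks finite_out h cong: if_cong)
  also have "\<dots> = (\<Sum>e'\<in>out_arcs G ?h. if e' \<noteq> arev e then nb_sum_after G arev f m e' else 0)"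
  proof (rule sum.cong[OF refl])
    fix e' assume "e' \<in> out_arcs G ?h"
    then have e': "e' \<in> arcs G" by simp
    then have "(\<Sum>p\<in>walks G (head G e') m. if ?ok (e' # p) then f (awlast (head G e') p) else 0)
        = nb_sum_after G arev f m e'"
      by (subst Suc.IH[OF e', symmetric], intro sum.inter_filter[symmetric] finite_walks) simp
    then show "(\<Sum>p\<in>walks G (head G e') m. if ?ok (e # e' # p) then f (awlast (head G e') p) else 0)
        = (if e' \<noteq> arev e then nb_sum_after G arev f m e' else 0)"
      by simp
  qed
  also have "\<dots> = nb_sum_after G arev f (Suc m) e"
    using finite_out[OF h] by (simp add: sum.inter_filter[symmetric] set_diff_eq)
  finally show ?case .
qed

lemma nb_walk_sum_0: "v \<in> verts G \<Longrightarrow> nb_walk_sum G arev v f 0 = f v"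
proof -
  assume "v \<in> verts G"
  then have "nb_walks G arev v 0 = {[]}" by (auto simp: nb_walks_def walks_0)
  then show ?thesis by (simp add: nb_walk_sum_def)
qed

lemma nb_walk_sum_Suc:
  assumes v: "v \<in> verts G"
  shows "nb_walk_sum G arev v f (Suc m) = (\<Sum>e\<in>out_arcs G v. nb_sum_after G arev f m e)"
proof -
  let ?ok = "successively (\<lambda>e e'. e' \<noteq> arev e)"
  have "nb_walk_sum G arev v f (Suc m)
      = (\<Sum>p \<in> walks G v (Suc m). if ?ok p then f (awlast v p) else 0)"
    unfolding nb_walk_sum_def nb_walks_def using finite_walks[OF v] by (intro sum.inter_filter)
  also have "\<dots> = (\<Sum>e\<in>out_arcs G v. \<Sum>p\<in>walks G (head G e) m.
      if ?ok (e # p) then f (awlast (head G e) p) else 0)"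
    by (subst sum_walks_Suc) (auto intro: finite_walks finite_out v cong: if_cong)
  also have "\<dots> = (\<Sum>e\<in>out_arcs G v. nb_sum_after G arev f m e)"
    by (intro sum.cong refl, subst sum_nb_walks_after[symmetric])
      (auto intro!: sum.inter_filter[symmetric] finite_walks)
  finally show ?thesis .
qed

text \<open>
  The non-backtracking walks that may follow the reversal of e, an arc into v, are those from v that
  do not begin with e.
\<close>
lemma nb_sum_after_arev:
  assumes v: "v \<in> verts G" and e: "e \<in> out_arcs G v"
  shows "nb_sum_after G arev f (Suc m) (arev e) = nb_walk_sum G arev v f (Suc m) - nb_sum_after G arev f m e"
proof -
  have "head G (arev e) = v" using e by simp
  then show ?thesis using e finite_out[OF v]
    by (simp add: nb_walk_sum_Suc[OF v] sum_diff1)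
qed

text \<open>
  A step from v followed by a non-empty non-backtracking walk is either a longer non-backtracking
  walk or the step, its reversal and a shorter non-backtracking walk p from v.  In the second case the
  first step can be any arc at v except the first arc of p, which leaves q (color v) choices, or one
  more if p is empty.
\<close>
lemma sum_nb_walk_sum_heads:
  assumes v: "v \<in> verts G"
  shows "(\<Sum>e\<in>out_arcs G v. nb_walk_sum G arev (head G e) f 0) = nb_walk_sum G arev v f 1"
    and "(\<Sum>e\<in>out_arcs G v. nb_walk_sum G arev (head G e) f (Suc m)) =
      nb_walk_sum G arev v f (Suc (Suc m)) + (if m = 0 then q (color v) + 1 else q (color v)) * nb_walk_sum G arev v f m"
proof -
  let ?A = "out_arcs G v" and ?c = "nb_sum_after G arev f"
  show "(\<Sum>e\<in>?A. nb_walk_sum G arev (head G e) f 0) = nb_walk_sum G arev v f 1"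
    by (simp add: nb_walk_sum_Suc[OF v] nb_walk_sum_0 One_nat_def del: One_nat_def[symmetric])
  have "(\<Sum>e\<in>?A. nb_walk_sum G arev (head G e) f (Suc m)) = (\<Sum>e\<in>?A. ?c (Suc m) e + ?c m (arev e))"
  proof (rule sum.cong[OF refl])
    fix e assume e: "e \<in> ?A"
    then have "arev e \<in> out_arcs G (head G e)" by simp
    then show "nb_walk_sum G arev (head G e) f (Suc m) = ?c (Suc m) e + ?c m (arev e)"
      using nb_sum_after_arev[of "head G e" "arev e" f m] e by simp
  qed
  also have "\<dots> = nb_walk_sum G arev v f (Suc (Suc m)) + (\<Sum>e\<in>?A. ?c m (arev e))"
    unfolding nb_walk_sum_Suc[OF v, of f "Suc m"] by (rule sum.distrib)
  also have "(\<Sum>e\<in>?A. ?c m (arev e)) = (if m = 0 then q (color v) + 1 else q (color v)) * nb_walk_sum G arev v f m"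
  proof (cases m)
    case 0
    have "(\<Sum>e\<in>?A. ?c m (arev e)) = (\<Sum>e\<in>?A. f v)"
      by (intro sum.cong) (auto simp: 0)
    then show ?thesis using degree[OF v] by (simp add: 0 nb_walk_sum_0 v out_degree_def)
  next
    case (Suc m')
    have "(\<Sum>e\<in>?A. ?c m (arev e)) = (\<Sum>e\<in>?A. nb_walk_sum G arev v f m - ?c m' e)"
      unfolding Suc by (intro sum.cong refl nb_sum_after_arev v)
    also have "\<dots> = q (color v) * nb_walk_sum G arev v f m"
      using degree[OF v] by (simp add: sum_subtractf nb_walk_sum_Suc[OF v] Suc out_degree_def algebra_simps)
    finally show ?thesis by (simp add: Suc)
  qed
  finally show "(\<Sum>e\<in>?A. nb_walk_sum G arev (head G e) f (Suc m)) =
      nb_walk_sum G arev v f (Suc (Suc m)) + (if m = 0 then q (color v) + 1 else q (color v)) * nb_walk_sum G arev v f m" .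
qed

text \<open>
  Deleting reversals reduces every walk to a unique non-backtracking one, and the number of
  walks of length r that reduce to a given one of length m is the number of walks of length r in the
  universal covering tree between two vertices at distance m.  The proof by induction on r
  avoids reduction and covering trees: the identity for the sums over the neighbours is
  the transpose of the recursion for the walk counts in the tree.
\<close>
lemma walk_sum_eq_tree_walks:
  assumes v: "v \<in> verts G"
  shows "walk_sum G v f r = (\<Sum>m\<le>r. tree_walks q r (color v) m * nb_walk_sum G arev v f m)"
  using v
proof (induction r arbitrary: v)
  case (Suc r)
  let ?A = "out_arcs G v" and ?t = "color v" and ?a = "nb_walk_sum G arev v f"
  let ?n = "tree_walks q r (\<not> ?t)" and ?d = "\<lambda>m::nat. if m = 0 then q ?t + 1 else q ?t"
  have "walk_sum G v f (Suc r) = (\<Sum>e\<in>?A. \<Sum>m\<le>r. ?n m * nb_walk_sum G arev (head G e) f m)"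
    unfolding walk_sum_Suc[OF Suc.prems]
    by (intro sum.cong refl) (auto simp: Suc.IH color_head)
  also have "\<dots> = (\<Sum>m\<le>r. ?n m * (\<Sum>e\<in>?A. nb_walk_sum G arev (head G e) f m))"
    by (subst sum.swap) (simp add: sum_distrib_left)
  also have "\<dots> = (\<Sum>m\<le>r. ?n m * ?a (Suc m) + (if m = 0 then 0 else ?n m * (?d (m - 1) * ?a (m - 1))))"
  proof (intro sum.cong refl)
    fix m show "?n m * (\<Sum>e\<in>?A. nb_walk_sum G arev (head G e) f m)
        = ?n m * ?a (Suc m) + (if m = 0 then 0 else ?n m * (?d (m - 1) * ?a (m - 1)))"
      using sum_nb_walk_sum_heads[OF Suc.prems] by (cases m) (auto simp: distrib_left)
  qed
  also have "\<dots> = (\<Sum>m\<le>r. ?n m * ?a (Suc m)) + (\<Sum>m\<le>r. if m = 0 then 0 else ?n m * (?d (m - 1) * ?a (m - 1)))"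
    by (rule sum.distrib)
  \<comment> \<open>The walk counts vanish beyond distance r, so the range may be extended before the shift.\<close>
  also have "(\<Sum>m\<le>r. if m = 0 then 0 else ?n m * (?d (m - 1) * ?a (m - 1)))
      = (\<Sum>m\<le>Suc (Suc r). if m = 0 then 0 else ?n m * (?d (m - 1) * ?a (m - 1)))"
    by (simp add: tree_walks_eq_0)
  also have "\<dots> = (\<Sum>m\<le>Suc r. ?n (Suc m) * (?d m * ?a m))"
    by (subst sum.atMost_Suc_shift) simp
  also have "(\<Sum>m\<le>r. ?n m * ?a (Suc m)) = (\<Sum>m\<le>Suc r. if m = 0 then 0 else ?n (m - 1) * ?a m)"
    by (subst sum.atMost_Suc_shift) simp
  also have "\<dots> + (\<Sum>m\<le>Suc r. ?n (Suc m) * (?d m * ?a m)) = (\<Sum>m\<le>Suc r. tree_walks q (Suc r) ?t m * ?a m)"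
    unfolding sum.distrib[symmetric]
  proof (intro sum.cong refl)
    fix m show "(if m = 0 then 0 else ?n (m - 1) * ?a m) + ?n (Suc m) * (?d m * ?a m)
        = tree_walks q (Suc r) ?t m * ?a m"
      by (cases m) (auto simp: algebra_simps)
  qed
  finally show ?case .
qed (simp add: walk_sum_0 nb_walk_sum_0)

text \<open>
  Some walk reaches a vertex where f is positive, and a sum over walks is a combination of sums over
  non-backtracking walks with non-negative coefficients.
\<close>
lemma exists_nb_walk_sum_pos:
  assumes conn: "Digraph_Component.connected G" and v: "v \<in> verts G"
    and f: "\<forall>x\<in>verts G. 0 \<le> f x" and x: "x \<in> verts G" "f x \<noteq> 0"
  shows "\<exists>m. 0 < nb_walk_sum G arev v f m"
proof (rule ccontr)
  assume none: "\<nexists>m. 0 < nb_walk_sum G arev v f m"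
  have "strongly_connected G"
    using symmetric_connected_imp_strongly_connected[OF sym_arcs conn] .
  then have "v \<rightarrow>\<^sup>*\<^bsub>G\<^esub> x" using v x by (auto simp: strongly_connected_def)
  then obtain p where p: "awalk v p x" by (auto simp: reachable_awalk)
  have "0 < walk_sum G v f (length p)"
    unfolding walk_sum_def
  proof (rule sum_pos2)
    show "finite (walks G v (length p))" by (rule finite_walks[OF v])
    show "p \<in> walks G v (length p)" using p by (auto simp: walks_def)
    show "0 < f (awlast v p)" using p f x by force
    fix p' assume "p' \<in> walks G v (length p)"
    then show "0 \<le> f (awlast v p')" using f by (auto simp: walks_def dest: awalk_last_in_verts)
  qed
  moreover have "walk_sum G v f (length p) \<le> 0"
    unfolding walk_sum_eq_tree_walks[OF v] using none tree_walks_nonneg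
    by (intro sum_nonpos mult_nonneg_nonpos) (auto simp: not_less)
  ultimately show False by simp
qed

end

section \<open>The growth rate formula\<close>

lemma ereal_sqrt_ereal: "ereal_sqrt (ereal x) = ereal (sqrt x)"
  by (simp add: ereal_sqrt_def)

theorem corollary1p1:
  fixes G :: "('v, 'e) pre_digraph" and arev :: "'e \<Rightarrow> 'e"
    and U W :: "'v set" and k l :: nat
    and f :: "'v \<Rightarrow> real" and v :: 'v
    and \<alpha> \<beta> :: ereal
  assumes "bidirected_digraph G arev"
    and "Digraph_Component.connected G"
    and "biregular G U W k l"
    and "2 \<le> k" and "2 \<le> l"
    and "\<forall>x \<in> verts G. 0 \<le> f x"
    and "\<exists>x \<in> verts G. f x \<noteq> 0"
    and "v \<in> verts G"
  defines "\<alpha> \<equiv> nb_growth G arev v f"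
    and "\<beta> \<equiv> walk_growth G v f"
  shows "(\<alpha> \<le> ereal ((real k - 1) powr (1/4) * (real l - 1) powr (1/4)) \<longrightarrow>
            \<beta> = ereal (sqrt (real k - 1) + sqrt (real l - 1))) \<and>
         (\<alpha> \<ge> ereal ((real k - 1) powr (1/4) * (real l - 1) powr (1/4)) \<longrightarrow>
            \<beta> = ereal_sqrt (\<alpha> + ereal (real k - 1) / \<alpha>) * ereal_sqrt (\<alpha> + ereal (real l - 1) / \<alpha>))"
proof -
  define q where "q t = (if t then real k - 1 else real l - 1)" for t
  define x0 where "x0 = (real k - 1) powr (1/4) * (real l - 1) powr (1/4)"
  interpret bidirected_digraph G arev by fact
  have deg: "out_degree G u = (if u \<in> U then k else l)" if "u \<in> verts G" for u
    using assms(3) that by (auto simp: biregular_def)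
  interpret biregular_graph G arev q "\<lambda>u. u \<in> U"
  proof unfold_locales
    show "1 \<le> q t" for t using assms(4,5) by (simp add: q_def)
    show "(head G e \<in> U) = (\<not> tail G e \<in> U)" if "e \<in> arcs G" for e
      using assms(3) that by (auto simp: biregular_def)
    show "real (out_degree G u) = q (u \<in> U) + 1" if "u \<in> verts G" for u
      using deg[OF that] by (simp add: q_def)
    show "finite (out_arcs G u)" if "u \<in> verts G" for u
    proof -
      have "0 < card (out_arcs G u)" using deg[OF that] assms(4,5) by (simp add: out_degree_def split: if_splits)
      then show ?thesis by (simp add: card_gt_0_iff)
    qed
  qed
  note v = assms(8)
  have a: "0 \<le> nb_walk_sum G arev v f m" for m
    unfolding nb_walk_sum_def nb_walks_def walks_def using assms(6)
    by (intro sum_nonneg) (auto dest: awalk_last_in_verts)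
  note b = walk_sum_eq_tree_walks[OF v, of f]
  obtain m where m: "0 < nb_walk_sum G arev v f m"
    using exists_nb_walk_sum_pos[OF assms(2) v assms(6)] assms(7) by blast
  have x0: "0 < x0" "x0 ^ 4 = q True * q False"
    using assms(4,5) by (auto simp: x0_def q_def power_mult_distrib powr_power)
  note transform = growth_transform[OF a b m x0, folded nb_growth_def walk_growth_def \<alpha>_def \<beta>_def]
  have "\<beta> = ereal_sqrt (\<alpha> + ereal (real k - 1) / \<alpha>) * ereal_sqrt (\<alpha> + ereal (real l - 1) / \<alpha>)"
    if ge: "\<alpha> \<ge> ereal x0"
  proof (cases \<alpha>)
    case (real x)
    then have "x0 \<le> x" using ge by simp
    then show ?thesis using transform(2)[OF real] x0(1)
      by (simp add: real ereal_sqrt_ereal rate_def q_def)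
  next
    case PInf
    then show ?thesis using transform(3) by (simp add: ereal_sqrt_def)
  qed (use ge in simp)
  then show ?thesis using transform(1) by (simp add: x0_def q_def)
qed

end
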